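(* For an $\mathbb{F}_1$-module $X$, the following are equivalent. (1) $X\cong\hat{H}\Psi X$. (2) For every $n\ge 0$ the following commutative square is a pullback diagram in $\mathsf{Set}_\ast$, where all products are indexed over all plasma morphisms $g\colon\mathcal{P}(2)\to\mathcal{P}(n)$: $$\begin{array}{ccc} X_n & \xrightarrow{\ \prod_S\rho_S^X\ } & X_1^{\mathcal{P}(n)}\\ {\scriptstyle p}\downarrow & & \downarrow{\scriptstyle\prod_g g^*}\\ \prod_g(\hat{H}\Psi X)_2 & \hookrightarrow & \prod_g X_1^{\mathcal{P}(2)}\end{array}$$ Here the top map is $x\mapsto(\rho_S^X(x))_{S\subseteq[n]}$; the right map has $g$-component $g^*\colon(x_S)_{S\subseteq[n]}\mapsto(x_{g(T)})_{T\subseteq[2]}$; the bottom map is the product of the inclusions $(\hat{H}\Psi X)_2\subseteq X_1^{\mathcal{P}(2)}$; and $p$ is the composite of the $n$-th component $X_n\to(\hat{H}\Psi X)_n$ of the unit of the adjunction $\Psi\dashv\hat{H}$ with $\prod_g g^*\colon(\hat{H}\Psi X)_n\to\prod_g(\hat{H}\Psi X)_2$.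
   Context: Plasmas. A plasma is a triple $(M,\boxplus,e)$ with $M$ a set, $\boxplus\colon M\times M\to\mathcal{P}(M)$ a function to the power set of $M$ and $e\in M$, such that $a\in e\boxplus a$ for all $a\in M$ and $a\boxplus b=b\boxplus a$ for all $a,b\in M$. A morphism $(M,\boxplus,e)\to(M',\star,e')$ is a function $f\colon M\to M'$ with $f(e)=e'$ and $f(a\boxplus b)\subseteq f(a)\star f(b)$. These form the category $\mathsf{Plas}$. $\mathbb{F}_1$-modules. $\mathsf{Fin}_\ast$ is the category whose objects are the pointed sets $\langle n\rangle=\{0,1,\ldots,n\}$, $n\ge 0$, with basepoint $0$, and whose morphisms are pointed functions; $\mathsf{Set}_\ast$ is the category of pointed sets. An $\mathbb{F}_1$-module is a functor $X\colon\mathsf{Fin}_\ast\to\mathsf{Set}_\ast$ such that $X(\langle 0\rangle)$ is a singleton; $\mathsf{Mod}_{\mathbb{F}_1}$ is the category of these and natural transformations. Write $X_n=X(\langle n\rangle)$, $\phi^X=X(\phi)$ and $[n]=\{1,\ldots,n\}$. For $S\subseteq[n]$, $\rho_S\colon\langle n\rangle\to\langle1\rangle$ is the pointed map with $\rho_S^{-1}(1)=S$. The plasmas $\mathcal{P}(n)$. $\mathcal{P}(n)$ is the set of subsets of $[n]$, with weak unit the empty subset and hyperoperation $S\curlyvee T=\{S\cup T\}$ if $S\cap T=\varnothing$, and $S\curlyvee T$ the empty set of elements of $\mathcal{P}(n)$ if $S\cap T\ne\varnothing$. The functor $\Psi\colon\mathsf{Mod}_{\mathbb{F}_1}\to\mathsf{Plas}$.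 Let $\rho_1,\rho_2,\alpha\colon\langle 2\rangle\to\langle 1\rangle$ be the pointed maps where $\rho_i$ sends $i$ to $1$ and every other element to $0$, and $\alpha$ sends both $1$ and $2$ to $1$. Let $e^X\in X_1$ be the image of $X_0\to X_1$, and put $x\boxplus_X y=\{\alpha^X(w): w\in X_2,\ \rho_1^X(w)=x,\ \rho_2^X(w)=y\}$. Then $\Psi X=(X_1,\boxplus_X,e^X)$ and $\Psi f=f_1$. The functor $\hat{H}\colon\mathsf{Plas}\to\mathsf{Mod}_{\mathbb{F}_1}$. For a plasma $(M,\boxplus,0)$, $$\hat{H}M_n=\{(x_S)_{S\subseteq[n]}: x_S\in M,\ x_\varnothing=0,\ x_{S\cup T}\in x_S\boxplus x_T\text{ whenever }S\cap T=\varnothing\},$$ pointed by the constant family $0$. A morphism $\phi\colon\langle n\rangle\to\langle m\rangle$ acts by $(x_S)_{S\subseteq[n]}\mapsto (x_{\phi^{-1}(T)})_{T\subseteq[m]}$; a plasma morphism $f$ induces $(x_S)_S\mapsto (f(x_S))_S$. $\hat{H}$ is right adjoint to $\Psi$, with unit $X_n\to(\hat{H}\Psi X)_n$, $z\mapsto(\rho_S^X(z))_{S\subseteq[n]}$. For a set $A$, $A^{\mathcal{P}(n)}$ is the set of families $(x_S)_{S\subseteq[n]}$ in $A$. *)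

theory Defs
  imports Main "HOL-Library.FuncSet"
begin

section \<open>Pointed sets\<close>

record 'a pset =
  elems :: "'a set"
  pt :: 'a

definition pointed :: "'a pset \<Rightarrow> bool" where
  "pointed A \<longleftrightarrow> pt A \<in> elems A"

text \<open>Maps are extensional (\<open>undefined\<close> off their domain), so that equality of morphisms is
  HOL equality; composition is \<^const>\<open>compose\<close>.\<close>

definition pmaps :: "'a pset \<Rightarrow> 'b pset \<Rightarrow> ('a \<Rightarrow> 'b) set" where
  "pmaps A B = {f \<in> elems A \<rightarrow>\<^sub>E elems B. f (pt A) = pt B}"

abbreviation pcomp :: "'a pset \<Rightarrow> ('b \<Rightarrow> 'c) \<Rightarrow> ('a \<Rightarrow> 'b) \<Rightarrow> 'a \<Rightarrow> 'c" where
  "pcomp A g f \<equiv> compose (elems A) g f"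

definition pid :: "'a pset \<Rightarrow> 'a \<Rightarrow> 'a" where
  "pid A = (\<lambda>x\<in>elems A. x)"

definition pprod :: "'i set \<Rightarrow> ('i \<Rightarrow> 'a pset) \<Rightarrow> ('i \<Rightarrow> 'a) pset" where
  "pprod I A = \<lparr>elems = (\<Pi>\<^sub>E i\<in>I. elems (A i)), pt = (\<lambda>i\<in>I. pt (A i))\<rparr>"

text \<open>The map \<open>A \<rightarrow> \<Prod>\<^sub>i B\<^sub>i\<close> with components \<open>h\<^sub>i\<close>, and the product of maps \<open>h\<^sub>i : A\<^sub>i \<rightarrow> B\<^sub>i\<close>.\<close>

definition ptuple :: "'a pset \<Rightarrow> 'i set \<Rightarrow> ('i \<Rightarrow> 'a \<Rightarrow> 'b) \<Rightarrow> 'a \<Rightarrow> 'i \<Rightarrow> 'b" where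
  "ptuple A I h = (\<lambda>x\<in>elems A. \<lambda>i\<in>I. h i x)"

definition pprod_map :: "'i set \<Rightarrow> ('i \<Rightarrow> 'a pset) \<Rightarrow> ('i \<Rightarrow> 'a \<Rightarrow> 'b) \<Rightarrow> ('i \<Rightarrow> 'a) \<Rightarrow> 'i \<Rightarrow> 'b" where
  "pprod_map I A h = (\<lambda>x\<in>elems (pprod I A). \<lambda>i\<in>I. h i (x i))"

text \<open>The square
  \<open>f : A \<rightarrow> B\<close> (top), \<open>g : A \<rightarrow> C\<close> (left), \<open>h : B \<rightarrow> D\<close> (right), \<open>k : C \<rightarrow> D\<close> (bottom)
  is a pullback of pointed sets. HOL cannot quantify over the types of the test objects inside
  a definition; the test type \<open>('b \<times> 'c) option\<close> is large enough to carry the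
  fibre product of \<open>h\<close> and \<open>k\<close> with a disjoint basepoint. The lemma \<open>is_pullback_universal\<close>
  below shows that the universal property then holds for test objects of every type.\<close>

definition is_pullback ::
  "'a pset \<Rightarrow> 'b pset \<Rightarrow> 'c pset \<Rightarrow> 'd pset \<Rightarrow>
   ('a \<Rightarrow> 'b) \<Rightarrow> ('a \<Rightarrow> 'c) \<Rightarrow> ('b \<Rightarrow> 'd) \<Rightarrow> ('c \<Rightarrow> 'd) \<Rightarrow> bool" where
  "is_pullback A B C D f g h k \<longleftrightarrow>
     pointed A \<and> pointed B \<and> pointed C \<and> pointed D \<and>
     f \<in> pmaps A B \<and> g \<in> pmaps A C \<and> h \<in> pmaps B D \<and> k \<in> pmaps C D \<and>
     pcomp A h f = pcomp A k g \<and>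
     (\<forall>(T :: ('b \<times> 'c) option pset) u v.
        pointed T \<and> u \<in> pmaps T B \<and> v \<in> pmaps T C \<and> pcomp T h u = pcomp T k v \<longrightarrow>
        (\<exists>!w. w \<in> pmaps T A \<and> pcomp T f w = u \<and> pcomp T g w = v))"

lemma is_pullback_bij:
  assumes "is_pullback A B C D f g h k"
  shows "bij_betw (\<lambda>a. (f a, g a)) (elems A)
           {(b, c). b \<in> elems B \<and> c \<in> elems C \<and> h b = k c}"
    (is "bij_betw ?F _ ?P")
proof -
  have pA: "pt A \<in> elems A" "pt B \<in> elems B" "pt C \<in> elems C"
    and f: "f \<in> elems A \<rightarrow>\<^sub>E elems B" "f (pt A) = pt B"
    and g: "g \<in> elems A \<rightarrow>\<^sub>E elems C" "g (pt A) = pt C"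
    and hk: "h (pt B) = pt D" "k (pt C) = pt D"
    and c: "pcomp A h f = pcomp A k g"
    using assms by (auto simp: is_pullback_def pointed_def pmaps_def)
  have comm: "h (f a) = k (g a)" if "a \<in> elems A" for a
    using fun_cong[OF c, of a] that by (simp add: compose_eq)
  have "\<exists>!a. a \<in> elems A \<and> f a = b \<and> g a = c" if bc: "(b, c) \<in> ?P" for b c
  proof -
    define T :: "('b \<times> 'c) option pset" where "T = \<lparr>elems = {None, Some (b, c)}, pt = None\<rparr>"
    define u where "u = (\<lambda>t\<in>elems T. case t of None \<Rightarrow> pt B | Some _ \<Rightarrow> b)"
    define v where "v = (\<lambda>t\<in>elems T. case t of None \<Rightarrow> pt C | Some _ \<Rightarrow> c)"
    have "pointed T" "u \<in> pmaps T B" "v \<in> pmaps T C" "pcomp T h u = pcomp T k v"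
      using bc pA hk by (auto simp: T_def u_def v_def pointed_def pmaps_def compose_def fun_eq_iff)
    then have ex1: "\<exists>!w. w \<in> pmaps T A \<and> pcomp T f w = u \<and> pcomp T g w = v"
      using assms unfolding is_pullback_def by blast
    have med: "(\<lambda>t\<in>elems T. case t of None \<Rightarrow> pt A | Some _ \<Rightarrow> a) \<in> pmaps T A \<and>
        pcomp T f (\<lambda>t\<in>elems T. case t of None \<Rightarrow> pt A | Some _ \<Rightarrow> a) = u \<and>
        pcomp T g (\<lambda>t\<in>elems T. case t of None \<Rightarrow> pt A | Some _ \<Rightarrow> a) = v"
      if "a \<in> elems A" "f a = b" "g a = c" for a
      using that pA f g
      by (auto simp: T_def u_def v_def pmaps_def compose_def fun_eq_iff)
    obtain w where w: "w \<in> pmaps T A" "pcomp T f w = u" "pcomp T g w = v"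
      using ex1 by blast
    have "w (Some (b, c)) \<in> elems A" "f (w (Some (b, c))) = b" "g (w (Some (b, c))) = c"
      using w(1) fun_cong[OF w(2), of "Some (b, c)"] fun_cong[OF w(3), of "Some (b, c)"]
      by (auto simp: T_def u_def v_def pmaps_def compose_def)
    moreover have "a = a'" if "a \<in> elems A" "f a = b" "g a = c"
      "a' \<in> elems A" "f a' = b" "g a' = c" for a a'
    proof -
      have "(\<lambda>t\<in>elems T. case t of None \<Rightarrow> pt A | Some _ \<Rightarrow> a) =
            (\<lambda>t\<in>elems T. case t of None \<Rightarrow> pt A | Some _ \<Rightarrow> a')"
        using ex1 med[OF that(1-3)] med[OF that(4-6)] by blast
      from fun_cong[OF this, of "Some (b, c)"] show ?thesis by (simp add: T_def)
    qed
    ultimately show ?thesis by blast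
  qed
  note ex = this
  have mem: "?F a \<in> ?P" if "a \<in> elems A" for a
    using that f g comm by auto
  show ?thesis
  proof (rule bij_betwI')
    fix x y assume xy: "x \<in> elems A" "y \<in> elems A"
    show "(?F x = ?F y) = (x = y)"
      using ex[OF mem[OF xy(1)]] xy by auto
  next
    fix p assume "p \<in> ?P"
    then show "\<exists>x\<in>elems A. p = ?F x"
      using ex[of "fst p" "snd p"] by (cases p) auto
  qed (rule mem)
qed

lemma bij_imp_universal:
  fixes T :: "'t pset"
  assumes bij: "bij_betw (\<lambda>a. (f a, g a)) (elems A)
           {(b, c). b \<in> elems B \<and> c \<in> elems C \<and> h b = k c}"
    and f: "f \<in> pmaps A B" and g: "g \<in> pmaps A C" and A: "pointed A"
    and T: "pointed T" and u: "u \<in> pmaps T B" and v: "v \<in> pmaps T C"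
    and uv: "pcomp T h u = pcomp T k v"
  shows "\<exists>!w. w \<in> pmaps T A \<and> pcomp T f w = u \<and> pcomp T g w = v"
proof -
  have inj: "a = a'" if "a \<in> elems A" "a' \<in> elems A" "f a = f a'" "g a = g a'" for a a'
    using bij that by (auto simp: bij_betw_def inj_on_def)
  have "\<exists>a\<in>elems A. f a = u t \<and> g a = v t" if t: "t \<in> elems T" for t
  proof -
    have "(u t, v t) \<in> (\<lambda>a. (f a, g a)) ` elems A"
      unfolding bij_betw_imp_surj_on[OF bij]
      using t u v fun_cong[OF uv, of t] by (auto simp: pmaps_def compose_def)
    then show ?thesis by auto
  qed
  then obtain w0 where w0: "\<And>t. t \<in> elems T \<Longrightarrow> w0 t \<in> elems A \<and> f (w0 t) = u t \<and> g (w0 t) = v t"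
    by metis
  have w0pt: "w0 (pt T) = pt A"
    using w0[of "pt T"] T A f g u v by (intro inj) (auto simp: pointed_def pmaps_def)
  show ?thesis
  proof (rule ex1I[where a = "restrict w0 (elems T)"])
    show "restrict w0 (elems T) \<in> pmaps T A \<and>
        pcomp T f (restrict w0 (elems T)) = u \<and> pcomp T g (restrict w0 (elems T)) = v"
      using w0 w0pt T u v
      by (auto simp: pmaps_def pointed_def compose_def fun_eq_iff PiE_iff extensional_def)
  next
    fix w assume w: "w \<in> pmaps T A \<and> pcomp T f w = u \<and> pcomp T g w = v"
    show "w = restrict w0 (elems T)"
    proof
      fix t
      show "w t = restrict w0 (elems T) t"
      proof (cases "t \<in> elems T")
        case True
        then show ?thesis
          using w w0[OF True] by (auto simp: pmaps_def compose_def intro!: inj)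
      next
        case False
        then show ?thesis using w by (auto simp: pmaps_def PiE_iff extensional_def)
      qed
    qed
  qed
qed

lemma is_pullback_universal:
  fixes T :: "'t pset"
  assumes "is_pullback A B C D f g h k"
    and "pointed T" "u \<in> pmaps T B" "v \<in> pmaps T C" "pcomp T h u = pcomp T k v"
  shows "\<exists>!w. w \<in> pmaps T A \<and> pcomp T f w = u \<and> pcomp T g w = v"
  using assms(1)
  by (intro bij_imp_universal[OF is_pullback_bij[OF assms(1)] _ _ _ assms(2-5)])
    (auto simp: is_pullback_def)


section \<open>Plasmas\<close>

record 'a plasma =
  car :: "'a set"
  hyp :: "'a \<Rightarrow> 'a \<Rightarrow> 'a set"
  unt :: 'a

definition is_plasma :: "'a plasma \<Rightarrow> bool" where
  "is_plasma M \<longleftrightarrow>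
     unt M \<in> car M \<and>
     (\<forall>a\<in>car M. \<forall>b\<in>car M. hyp M a b \<subseteq> car M) \<and>
     (\<forall>a\<in>car M. a \<in> hyp M (unt M) a) \<and>
     (\<forall>a\<in>car M. \<forall>b\<in>car M. hyp M a b = hyp M b a)"

definition plasma_homs :: "'a plasma \<Rightarrow> 'b plasma \<Rightarrow> ('a \<Rightarrow> 'b) set" where
  "plasma_homs M N =
     {f \<in> car M \<rightarrow>\<^sub>E car N. f (unt M) = unt N \<and>
        (\<forall>a\<in>car M. \<forall>b\<in>car M. f ` hyp M a b \<subseteq> hyp N (f a) (f b))}"

definition Pplasma :: "nat \<Rightarrow> nat set plasma" where
  "Pplasma n = \<lparr>car = Pow {1..n},
     hyp = (\<lambda>S T. if S \<inter> T = {} then {S \<union> T} else {}),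
     unt = {}\<rparr>"

lemma is_plasma_Pplasma: "is_plasma (Pplasma n)"
  by (auto simp: is_plasma_def Pplasma_def)


section \<open>F1-modules\<close>

definition Fin :: "nat \<Rightarrow> nat pset" where
  "Fin n = \<lparr>elems = {0..n}, pt = 0\<rparr>"

text \<open>\<open>act X n m \<phi>\<close> is the value of the functor \<open>X\<close> on \<open>\<phi> : \<langle>n\<rangle> \<rightarrow> \<langle>m\<rangle>\<close>.\<close>

record 'a fin_functor =
  ob :: "nat \<Rightarrow> 'a pset"
  act :: "nat \<Rightarrow> nat \<Rightarrow> (nat \<Rightarrow> nat) \<Rightarrow> 'a \<Rightarrow> 'a"

definition F1_module :: "'a fin_functor \<Rightarrow> bool" where
  "F1_module X \<longleftrightarrow>
     (\<forall>n. pointed (ob X n)) \<and>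
     (\<forall>n m. \<forall>\<phi>\<in>pmaps (Fin n) (Fin m). act X n m \<phi> \<in> pmaps (ob X n) (ob X m)) \<and>
     (\<forall>n. act X n n (pid (Fin n)) = pid (ob X n)) \<and>
     (\<forall>n m l. \<forall>\<phi>\<in>pmaps (Fin n) (Fin m). \<forall>\<psi>\<in>pmaps (Fin m) (Fin l).
        act X n l (pcomp (Fin n) \<psi> \<phi>) = pcomp (ob X n) (act X m l \<psi>) (act X n m \<phi>)) \<and>
     (\<exists>x. elems (ob X 0) = {x})"

definition nat_trans :: "'a fin_functor \<Rightarrow> 'b fin_functor \<Rightarrow> (nat \<Rightarrow> 'a \<Rightarrow> 'b) \<Rightarrow> bool" where
  "nat_trans X Y f \<longleftrightarrow>
     (\<forall>n. f n \<in> pmaps (ob X n) (ob Y n)) \<and>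
     (\<forall>n m. \<forall>\<phi>\<in>pmaps (Fin n) (Fin m).
        pcomp (ob X n) (f m) (act X n m \<phi>) = pcomp (ob X n) (act Y n m \<phi>) (f n))"

definition F1_iso :: "'a fin_functor \<Rightarrow> 'b fin_functor \<Rightarrow> bool" where
  "F1_iso X Y \<longleftrightarrow>
     (\<exists>f g. nat_trans X Y f \<and> nat_trans Y X g \<and>
        (\<forall>n. pcomp (ob X n) (g n) (f n) = pid (ob X n) \<and>
             pcomp (ob Y n) (f n) (g n) = pid (ob Y n)))"

definition rho :: "nat \<Rightarrow> nat set \<Rightarrow> nat \<Rightarrow> nat" where
  "rho n S = (\<lambda>i\<in>{0..n}. if i \<in> S then 1 else 0)"

lemma rho_pmaps: "S \<subseteq> {1..n} \<Longrightarrow> rho n S \<in> pmaps (Fin n) (Fin 1)"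
  by (auto simp: rho_def pmaps_def Fin_def)

text \<open>The three maps \<open>\<rho>\<^sub>1, \<rho>\<^sub>2, \<alpha> : \<langle>2\<rangle> \<rightarrow> \<langle>1\<rangle>\<close> are \<open>rho 2 {1}\<close>, \<open>rho 2 {2}\<close> and \<open>rho 2 {1, 2}\<close>;
  \<open>rho 0 {}\<close> is the only pointed map \<open>\<langle>0\<rangle> \<rightarrow> \<langle>1\<rangle>\<close>.\<close>

definition Psi :: "'a fin_functor \<Rightarrow> 'a plasma" where
  "Psi X = \<lparr>car = elems (ob X 1),
     hyp = (\<lambda>x y. {act X 2 1 (rho 2 {1, 2}) w | w.
       w \<in> elems (ob X 2) \<and> act X 2 1 (rho 2 {1}) w = x \<and> act X 2 1 (rho 2 {2}) w = y}),
     unt = act X 0 1 (rho 0 {}) (pt (ob X 0))\<rparr>"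

definition Hfam :: "'a plasma \<Rightarrow> nat \<Rightarrow> (nat set \<Rightarrow> 'a) pset" where
  "Hfam M n = \<lparr>
     elems = {x \<in> Pow {1..n} \<rightarrow>\<^sub>E car M. x {} = unt M \<and>
       (\<forall>S\<in>Pow {1..n}. \<forall>T\<in>Pow {1..n}. S \<inter> T = {} \<longrightarrow> x (S \<union> T) \<in> hyp M (x S) (x T))},
     pt = (\<lambda>S\<in>Pow {1..n}. unt M)\<rparr>"

definition Hhat :: "'a plasma \<Rightarrow> (nat set \<Rightarrow> 'a) fin_functor" where
  "Hhat M = \<lparr>ob = Hfam M,
     act = (\<lambda>n m \<phi>. \<lambda>x\<in>elems (Hfam M n). \<lambda>T\<in>Pow {1..m}. x {i \<in> {0..n}. \<phi> i \<in> T})\<rparr>"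

text \<open>The unit \<open>X \<rightarrow> Hhat (Psi X)\<close> of the adjunction between \<^const>\<open>Psi\<close> and \<^const>\<open>Hhat\<close>.\<close>

definition adj_unit :: "'a fin_functor \<Rightarrow> nat \<Rightarrow> 'a \<Rightarrow> nat set \<Rightarrow> 'a" where
  "adj_unit X n = (\<lambda>z\<in>elems (ob X n). \<lambda>S\<in>Pow {1..n}. act X n 1 (rho n S) z)"


subsection \<open>The constructions are well defined\<close>

lemma F1_module_comp:
  assumes "F1_module X" "\<phi> \<in> pmaps (Fin n) (Fin m)" "\<psi> \<in> pmaps (Fin m) (Fin l)"
    and "x \<in> elems (ob X n)"
  shows "act X m l \<psi> (act X n m \<phi> x) = act X n l (pcomp (Fin n) \<psi> \<phi>) x"
proof -
  have "act X n l (pcomp (Fin n) \<psi> \<phi>) = pcomp (ob X n) (act X m l \<psi>) (act X n m \<phi>)"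
    using assms unfolding F1_module_def by blast
  then show ?thesis using assms(4) by (simp add: compose_eq)
qed

lemma F1_module_closed:
  assumes "F1_module X" "\<phi> \<in> pmaps (Fin n) (Fin m)" "x \<in> elems (ob X n)"
  shows "act X n m \<phi> x \<in> elems (ob X m)"
proof -
  have "act X n m \<phi> \<in> pmaps (ob X n) (ob X m)"
    using assms unfolding F1_module_def by blast
  then show ?thesis using assms(3) by (auto simp: pmaps_def)
qed

lemma pcomp_rho:
  assumes "\<phi> \<in> pmaps (Fin n) (Fin m)"
  shows "pcomp (Fin n) (rho m T) \<phi> = rho n {i \<in> {0..n}. \<phi> i \<in> T}"
  using assms by (auto simp: rho_def compose_def Fin_def pmaps_def fun_eq_iff PiE_iff)

lemma rho_singleton_id: "rho 1 {1} = pid (Fin 1)"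
  by (auto simp: rho_def pid_def Fin_def fun_eq_iff)

lemma F1_module_id:
  assumes "F1_module X" "x \<in> elems (ob X n)"
  shows "act X n n (pid (Fin n)) x = x"
proof -
  have "act X n n (pid (Fin n)) = pid (ob X n)"
    using assms unfolding F1_module_def by blast
  then show ?thesis using assms(2) by (simp add: pid_def)
qed

lemma act_rho_empty:
  assumes X: "F1_module X" and z: "z \<in> elems (ob X n)"
  shows "act X n 1 (rho n {}) z = unt (Psi X)"
proof -
  define c :: "nat \<Rightarrow> nat" where "c = (\<lambda>i\<in>{0..n}. 0)"
  have c: "c \<in> pmaps (Fin n) (Fin 0)"
    by (auto simp: c_def pmaps_def Fin_def)
  obtain e where e: "elems (ob X 0) = {e}" using X unfolding F1_module_def by blast
  have "pt (ob X 0) = e" using X e unfolding F1_module_def pointed_def by blast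
  moreover have "act X n 0 c z = e" using F1_module_closed[OF X c z] e by simp
  moreover have "act X 0 1 (rho 0 {}) (act X n 0 c z) = act X n 1 (rho n {}) z"
    using F1_module_comp[OF X c rho_pmaps z, of "{}" ] pcomp_rho[OF c, of "{}"] by simp
  ultimately show ?thesis by (simp add: Psi_def)
qed

lemma is_plasma_Psi:
  assumes X: "F1_module X"
  shows "is_plasma (Psi X)"
proof -
  have cl: "act X n 1 (rho n S) z \<in> elems (ob X 1)" if "S \<subseteq> {1..n}" "z \<in> elems (ob X n)" for n S z
    using F1_module_closed[OF X rho_pmaps] that by blast
  have ptX: "pt (ob X 0) \<in> elems (ob X 0)" using X unfolding F1_module_def pointed_def by blast
  have unit: "a \<in> hyp (Psi X) (unt (Psi X)) a" if a: "a \<in> elems (ob X 1)" for a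
  proof -
    define j :: "nat \<Rightarrow> nat" where "j = (\<lambda>i\<in>{0..1}. if i = 1 then 2 else 0)"
    have j: "j \<in> pmaps (Fin 1) (Fin 2)" by (auto simp: j_def pmaps_def Fin_def)
    let ?w = "act X 1 2 j a"
    have eq: "act X 2 1 (rho 2 S) ?w = act X 1 1 (rho 1 {i \<in> {0..1}. j i \<in> S}) a"
      if "S \<subseteq> {1..2}" for S
      using F1_module_comp[OF X j rho_pmaps[OF that] a] pcomp_rho[OF j] by simp
    have s: "{i \<in> {0..1}. j i \<in> {1}} = {}" "{i \<in> {0..1}. j i \<in> {2}} = {1}"
      "{i \<in> {0..1}. j i \<in> {1,2}} = {1}" by (auto simp: j_def)
    have "?w \<in> elems (ob X 2)" by (rule F1_module_closed[OF X j a])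
    moreover have "act X 2 1 (rho 2 {1}) ?w = unt (Psi X)"
      using eq[of "{1}"] act_rho_empty[OF X a] unfolding s by simp
    moreover have "act X 2 1 (rho 2 {2}) ?w = a"
      using eq[of "{2}"] F1_module_id[OF X a] unfolding s rho_singleton_id by simp
    moreover have "act X 2 1 (rho 2 {1,2}) ?w = a"
      using eq[of "{1,2}"] F1_module_id[OF X a] unfolding s rho_singleton_id by simp
    ultimately show ?thesis unfolding Psi_def by force
  qed
  have comm: "hyp (Psi X) a b \<subseteq> hyp (Psi X) b a" for a b
  proof
    fix y assume "y \<in> hyp (Psi X) a b"
    then obtain w where w: "w \<in> elems (ob X 2)" "act X 2 1 (rho 2 {1}) w = a"
      "act X 2 1 (rho 2 {2}) w = b" "y = act X 2 1 (rho 2 {1,2}) w"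
      by (auto simp: Psi_def)
    define j :: "nat \<Rightarrow> nat" where "j = (\<lambda>i\<in>{0..2}. if i = 1 then 2 else if i = 2 then 1 else 0)"
    have j: "j \<in> pmaps (Fin 2) (Fin 2)" by (auto simp: j_def pmaps_def Fin_def)
    have eq: "act X 2 1 (rho 2 S) (act X 2 2 j w) = act X 2 1 (rho 2 {i \<in> {0..2}. j i \<in> S}) w"
      if "S \<subseteq> {1..2}" for S
      using F1_module_comp[OF X j rho_pmaps[OF that] w(1)] pcomp_rho[OF j] by simp
    have s: "{i \<in> {0..2}. j i \<in> {1}} = {2}" "{i \<in> {0..2}. j i \<in> {2}} = {1}"
      "{i \<in> {0..2}. j i \<in> {1,2}} = {1,2}" by (auto simp: j_def)
    show "y \<in> hyp (Psi X) b a"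
      using F1_module_closed[OF X j w(1)] eq[of "{1}"] eq[of "{2}"] eq[of "{1,2}"] w
      unfolding s by (auto simp: Psi_def intro!: exI[of _ "act X 2 2 j w"])
  qed
  have car: "unt (Psi X) \<in> car (Psi X)" "hyp (Psi X) a b \<subseteq> car (Psi X)" for a b
    using cl[of "{1,2}" 2] cl[of "{}" 0] ptX by (auto simp: Psi_def)
  have "car (Psi X) = elems (ob X 1)" by (simp add: Psi_def)
  then show ?thesis
    unfolding is_plasma_def using unit car comm by (simp add: subset_antisym)
qed

lemma F1_module_Hhat:
  assumes M: "is_plasma M"
  shows "F1_module (Hhat M)"
proof -
  have pre: "{i \<in> {0..n}. \<phi> i \<in> T} \<subseteq> {1..n}"
    if "\<phi> \<in> pmaps (Fin n) (Fin m)" "T \<subseteq> {1..m}" for \<phi> n m T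
    using that by (auto simp: pmaps_def Fin_def) (metis atLeastAtMost_iff not_less_eq_eq one_le_numeral le_zero_eq subset_iff not_one_le_zero)
  have un: "unt M \<in> hyp M (unt M) (unt M)" "unt M \<in> car M" using M by (auto simp: is_plasma_def)
  have 1: "pointed (Hfam M n)" for n
    using un by (auto simp: pointed_def Hfam_def)
  have 2: "act (Hhat M) n m \<phi> \<in> pmaps (Hfam M n) (Hfam M m)"
    if p: "\<phi> \<in> pmaps (Fin n) (Fin m)" for n m \<phi>
  proof -
    have "(\<lambda>T\<in>Pow {1..m}. x {i \<in> {0..n}. \<phi> i \<in> T}) \<in> elems (Hfam M m)"
      if x: "x \<in> elems (Hfam M n)" for x
    proof -
      have "x ({i \<in> {0..n}. \<phi> i \<in> S \<union> T}) \<in>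
          hyp M (x {i \<in> {0..n}. \<phi> i \<in> S}) (x {i \<in> {0..n}. \<phi> i \<in> T})"
        if "S \<subseteq> {1..m}" "T \<subseteq> {1..m}" "S \<inter> T = {}" for S T
      proof -
        have u: "{i \<in> {0..n}. \<phi> i \<in> S \<union> T} = {i \<in> {0..n}. \<phi> i \<in> S} \<union> {i \<in> {0..n}. \<phi> i \<in> T}"
          by auto
        have d: "{i \<in> {0..n}. \<phi> i \<in> S} \<inter> {i \<in> {0..n}. \<phi> i \<in> T} = {}" using that by auto
        show ?thesis unfolding u using x pre[OF p that(1)] pre[OF p that(2)] d
          by (simp add: Hfam_def)
      qed
      then show ?thesis using x pre[OF p] by (auto simp: Hfam_def PiE_iff)
    qed
    moreover have "(\<lambda>T\<in>Pow {1..m}. pt (Hfam M n) {i \<in> {0..n}. \<phi> i \<in> T}) = pt (Hfam M m)"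
      using pre[OF p] by (auto simp: Hfam_def fun_eq_iff)
    ultimately show ?thesis using 1[of n] by (auto simp: pmaps_def Hhat_def pointed_def)
  qed
  have 3: "act (Hhat M) n n (pid (Fin n)) = pid (Hfam M n)" for n
  proof -
    have "(\<lambda>T\<in>Pow {1..n}. x {i \<in> {0..n}. pid (Fin n) i \<in> T}) = x" if "x \<in> elems (Hfam M n)" for x
    proof -
      have "{i \<in> {0..n}. pid (Fin n) i \<in> T} = T" if "T \<subseteq> {1..n}" for T
        using that by (auto simp: pid_def Fin_def)
      then show ?thesis using that by (auto simp: Hfam_def fun_eq_iff PiE_iff extensional_def)
    qed
    then show ?thesis by (auto simp: Hhat_def pid_def fun_eq_iff)
  qed
  have 4: "act (Hhat M) n l (pcomp (Fin n) \<psi> \<phi>) = pcomp (Hfam M n) (act (Hhat M) m l \<psi>) (act (Hhat M) n m \<phi>)"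
    if p: "\<phi> \<in> pmaps (Fin n) (Fin m)" and q: "\<psi> \<in> pmaps (Fin m) (Fin l)" for n m l \<phi> \<psi>
  proof
    fix x
    have e: "{i. i \<le> n \<and> pcomp (Fin n) \<psi> \<phi> i \<in> T} = {i. i \<le> n \<and> \<phi> i \<le> m \<and> \<psi> (\<phi> i) \<in> T}" for T
      using p by (auto simp: compose_def pmaps_def Fin_def PiE_iff)
    show "act (Hhat M) n l (pcomp (Fin n) \<psi> \<phi>) x = pcomp (Hfam M n) (act (Hhat M) m l \<psi>) (act (Hhat M) n m \<phi>) x"
    proof (cases "x \<in> elems (Hfam M n)")
      case True
      then have "act (Hhat M) n m \<phi> x \<in> elems (Hfam M m)" using 2[OF p] by (auto simp: pmaps_def)
      then show ?thesis using True pre[OF q]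
        by (auto simp: Hhat_def compose_def[of "elems (Hfam M n)"] e fun_eq_iff)
    next
      case False
      then show ?thesis by (simp add: Hhat_def compose_def)
    qed
  qed
  have "elems (Hfam M 0) = {\<lambda>S\<in>{{}}. unt M}"
    using un by (auto simp: Hfam_def PiE_iff extensional_def fun_eq_iff split: if_splits)
  then show ?thesis
    unfolding F1_module_def using 1 2 3 4 by (auto simp: Hhat_def)
qed

lemma adj_unit_mem:
  assumes X: "F1_module X" and z: "z \<in> elems (ob X n)"
  shows "adj_unit X n z \<in> elems (ob (Hhat (Psi X)) n)"
proof -
  have "act X n 1 (rho n (S \<union> T)) z \<in> hyp (Psi X) (act X n 1 (rho n S) z) (act X n 1 (rho n T) z)"
    if ST: "S \<subseteq> {1..n}" "T \<subseteq> {1..n}" "S \<inter> T = {}" for S T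
  proof -
    define j :: "nat \<Rightarrow> nat" where "j = (\<lambda>i\<in>{0..n}. if i \<in> S then 1 else if i \<in> T then 2 else 0)"
    have j: "j \<in> pmaps (Fin n) (Fin 2)" using ST by (auto simp: j_def pmaps_def Fin_def)
    have s: "{i \<in> {0..n}. j i \<in> {1}} = S" "{i \<in> {0..n}. j i \<in> {2}} = T"
      "{i \<in> {0..n}. j i \<in> {1,2}} = S \<union> T" using ST by (auto simp: j_def)
    have eq: "act X 2 1 (rho 2 U) (act X n 2 j z) = act X n 1 (rho n {i \<in> {0..n}. j i \<in> U}) z"
      if "U \<subseteq> {1..2}" for U
      using F1_module_comp[OF X j rho_pmaps[OF that] z] pcomp_rho[OF j] by simp
    show ?thesis
      using F1_module_closed[OF X j z] eq[of "{1}"] eq[of "{2}"] eq[of "{1,2}"]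
      unfolding s Psi_def by force
  qed
  then show ?thesis
    using z act_rho_empty[OF X z] F1_module_closed[OF X rho_pmaps z]
    by (auto simp: adj_unit_def Hhat_def Hfam_def Psi_def)
qed

lemma nat_trans_adj_unit:
  assumes X: "F1_module X"
  shows "nat_trans X (Hhat (Psi X)) (adj_unit X)"
proof -
  have pre: "{i \<in> {0..n}. \<phi> i \<in> T} \<subseteq> {1..n}"
    if "\<phi> \<in> pmaps (Fin n) (Fin m)" "T \<subseteq> {1..m}" for \<phi> n m T
    using that by (auto simp: pmaps_def Fin_def) (metis atLeastAtMost_iff not_less_eq_eq one_le_numeral le_zero_eq subset_iff not_one_le_zero)
  have pt: "act X n m \<phi> (pt (ob X n)) = pt (ob X m)" if "\<phi> \<in> pmaps (Fin n) (Fin m)" for n m \<phi>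
    using X that unfolding F1_module_def pmaps_def[of "ob X _"] by blast
  have ptm: "pt (ob X n) \<in> elems (ob X n)" for n using X by (auto simp: F1_module_def pointed_def)
  have u: "unt (Psi X) = pt (ob X 1)"
    using pt[OF rho_pmaps[of "{}" 0]] by (simp add: Psi_def)
  have A: "adj_unit X n \<in> pmaps (ob X n) (ob (Hhat (Psi X)) n)" for n
    using adj_unit_mem[OF X] pt[OF rho_pmaps] ptm[of n] u
    by (auto simp: pmaps_def Hhat_def Hfam_def adj_unit_def fun_eq_iff)
  have B: "adj_unit X m (act X n m \<phi> z) = act (Hhat (Psi X)) n m \<phi> (adj_unit X n z)"
    if p: "\<phi> \<in> pmaps (Fin n) (Fin m)" and z: "z \<in> elems (ob X n)" for n m \<phi> z
    using adj_unit_mem[OF X z] F1_module_closed[OF X p z] z pre[OF p]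
      F1_module_comp[OF X p rho_pmaps z] pcomp_rho[OF p]
    by (auto simp: adj_unit_def Hhat_def fun_eq_iff)
  show ?thesis unfolding nat_trans_def using A B by (auto simp: compose_def fun_eq_iff)
qed


section \<open>The square\<close>

text \<open>The pointed set of all families in \<open>A\<close> indexed by the subsets of \<open>{1..n}\<close>.\<close>

definition Pfam :: "'a pset \<Rightarrow> nat \<Rightarrow> (nat set \<Rightarrow> 'a) pset" where
  "Pfam A n = pprod (Pow {1..n}) (\<lambda>_. A)"

abbreviation P2_homs :: "nat \<Rightarrow> (nat set \<Rightarrow> nat set) set" where
  "P2_homs n \<equiv> plasma_homs (Pplasma 2) (Pplasma n)"

text \<open>The map \<open>g\<^sup>*\<close> on a pointed set \<open>B\<close> of families; it is used both for
  \<^term>\<open>Pfam (ob X 1) n\<close> and for \<^term>\<open>ob (Hhat (Psi X)) n\<close>.\<close>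

definition gstar ::
  "(nat set \<Rightarrow> 'a) pset \<Rightarrow> (nat set \<Rightarrow> nat set) \<Rightarrow> (nat set \<Rightarrow> 'a) \<Rightarrow> nat set \<Rightarrow> 'a" where
  "gstar B g = (\<lambda>x\<in>elems B. \<lambda>T\<in>Pow {1..2}. x (g T))"

definition sq_top :: "'a fin_functor \<Rightarrow> nat \<Rightarrow> 'a \<Rightarrow> nat set \<Rightarrow> 'a" where
  "sq_top X n = ptuple (ob X n) (Pow {1..n}) (\<lambda>S. act X n 1 (rho n S))"

definition sq_right ::
  "'a fin_functor \<Rightarrow> nat \<Rightarrow> (nat set \<Rightarrow> 'a) \<Rightarrow> (nat set \<Rightarrow> nat set) \<Rightarrow> nat set \<Rightarrow> 'a" where
  "sq_right X n = ptuple (Pfam (ob X 1) n) (P2_homs n) (gstar (Pfam (ob X 1) n))"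

definition sq_left ::
  "'a fin_functor \<Rightarrow> nat \<Rightarrow> 'a \<Rightarrow> (nat set \<Rightarrow> nat set) \<Rightarrow> nat set \<Rightarrow> 'a" where
  "sq_left X n = pcomp (ob X n)
     (ptuple (ob (Hhat (Psi X)) n) (P2_homs n) (gstar (ob (Hhat (Psi X)) n)))
     (adj_unit X n)"

definition sq_bottom ::
  "'a fin_functor \<Rightarrow> nat \<Rightarrow> ((nat set \<Rightarrow> nat set) \<Rightarrow> nat set \<Rightarrow> 'a) \<Rightarrow>
   (nat set \<Rightarrow> nat set) \<Rightarrow> nat set \<Rightarrow> 'a" where
  "sq_bottom X n = pprod_map (P2_homs n) (\<lambda>_. ob (Hhat (Psi X)) 2)
     (\<lambda>_. \<lambda>x\<in>elems (ob (Hhat (Psi X)) 2). x)"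

lemma P2_hom_sub: "g \<in> P2_homs n \<Longrightarrow> S \<subseteq> {1..2} \<Longrightarrow> g S \<subseteq> {1..n}"
  by (auto simp: plasma_homs_def Pplasma_def PiE_iff)

lemma P2_hom_empty: "g \<in> P2_homs n \<Longrightarrow> g {} = {}"
  by (auto simp: plasma_homs_def Pplasma_def PiE_iff)

lemma P2_hom_un: assumes "g \<in> P2_homs n" "S \<subseteq> {1..2}" "T \<subseteq> {1..2}" "S \<inter> T = {}"
  shows "g S \<inter> g T = {} \<and> g (S \<union> T) = g S \<union> g T"
proof -
  have "g ` (if S \<inter> T = {} then {S \<union> T} else {}) \<subseteq> (if g S \<inter> g T = {} then {g S \<union> g T} else {})"
    using assms(1-3) by (auto simp: plasma_homs_def Pplasma_def PiE_iff)
  then show ?thesis using assms(4) by (auto split: if_splits)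
qed

lemma gstar_Hfam: assumes "g \<in> P2_homs n" "x \<in> elems (Hfam M n)"
  shows "(\<lambda>T\<in>Pow {1..2}. x (g T)) \<in> elems (Hfam M 2)"
  using assms P2_hom_un[OF assms(1)] P2_hom_sub[OF assms(1)] P2_hom_empty[OF assms(1)]
  by (auto simp: Hfam_def PiE_iff)

lemma F1_module_basepoints: assumes X: "F1_module X" shows "unt (Psi X) = pt (ob X 1)" "pt (ob X n) \<in> elems (ob X n)"
proof -
  have "act X 0 1 (rho 0 {}) (pt (ob X 0)) = pt (ob X 1)"
    using X rho_pmaps[of "{}" 0] unfolding F1_module_def pmaps_def[of "ob X _"] by blast
  then show "unt (Psi X) = pt (ob X 1)" by (simp add: Psi_def)
  show "pt (ob X n) \<in> elems (ob X n)" using X by (auto simp: F1_module_def pointed_def)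
qed

lemma square_commutes:
  assumes X: "F1_module X"
  shows "sq_top X n \<in> pmaps (ob X n) (Pfam (ob X 1) n)"
    and "sq_right X n \<in> pmaps (Pfam (ob X 1) n) (pprod (P2_homs n) (\<lambda>_. Pfam (ob X 1) 2))"
    and "sq_left X n \<in> pmaps (ob X n) (pprod (P2_homs n) (\<lambda>_. ob (Hhat (Psi X)) 2))"
    and "sq_bottom X n \<in> pmaps (pprod (P2_homs n) (\<lambda>_. ob (Hhat (Psi X)) 2)) (pprod (P2_homs n) (\<lambda>_. Pfam (ob X 1) 2))"
    and "pcomp (ob X n) (sq_right X n) (sq_top X n) = pcomp (ob X n) (sq_bottom X n) (sq_left X n)"
proof -
  have pt: "act X n m \<phi> (pt (ob X n)) = pt (ob X m)" if "\<phi> \<in> pmaps (Fin n) (Fin m)" for n m \<phi>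
    using X that unfolding F1_module_def pmaps_def[of "ob X _"] by blast
  have sub: "elems (Hfam (Psi X) m) \<subseteq> elems (Pfam (ob X 1) m)" for m
    by (auto simp: Hfam_def Pfam_def pprod_def Psi_def)
  have obH: "ob (Hhat (Psi X)) m = Hfam (Psi X) m" for m by (simp add: Hhat_def)
  have un: "adj_unit X n z \<in> elems (Hfam (Psi X) n)" if "z \<in> elems (ob X n)" for z
    using adj_unit_mem[OF X that] by (simp add: obH)
  have top: "sq_top X n = adj_unit X n" by (simp add: sq_top_def adj_unit_def ptuple_def)
  have ppt: "pt (Hfam (Psi X) m) = pt (Pfam (ob X 1) m)" for m
    by (simp add: Hfam_def Pfam_def pprod_def F1_module_basepoints[OF X])
  have unpt: "adj_unit X n (pt (ob X n)) = pt (Pfam (ob X 1) n)"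
    using F1_module_basepoints(2)[OF X] pt[OF rho_pmaps] by (auto simp: adj_unit_def Pfam_def pprod_def fun_eq_iff)
  show "sq_top X n \<in> pmaps (ob X n) (Pfam (ob X 1) n)"
    using un sub unpt unfolding top pmaps_def by (auto simp: adj_unit_def)
  have gpt: "(\<lambda>T\<in>Pow {1..2}. pt (Pfam (ob X 1) n) (g T)) = pt (Pfam (ob X 1) 2)" if "g \<in> P2_homs n" for g
    using P2_hom_sub[OF that] by (auto simp: Pfam_def pprod_def fun_eq_iff)
  have ptP: "pt (Pfam (ob X 1) n) \<in> elems (Pfam (ob X 1) n)" for n
    using F1_module_basepoints(2)[OF X] by (auto simp: Pfam_def pprod_def)
  have gm: "(\<lambda>T\<in>Pow {1..2}. x (g T)) \<in> elems (Pfam (ob X 1) 2)" if "g \<in> P2_homs n" "x \<in> elems (Pfam (ob X 1) n)" for g x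
    using P2_hom_sub[OF that(1)] that(2) by (auto simp: Pfam_def pprod_def PiE_iff)
  show "sq_right X n \<in> pmaps (Pfam (ob X 1) n) (pprod (P2_homs n) (\<lambda>_. Pfam (ob X 1) 2))"
    using gpt ptP gm
    by (auto simp: sq_right_def ptuple_def gstar_def pmaps_def pprod_def[of "P2_homs n"] fun_eq_iff)
  have ptH: "pt (Pfam (ob X 1) n) \<in> elems (Hfam (Psi X) n)"
    using un[OF F1_module_basepoints(2)[OF X]] unpt by simp
  show "sq_left X n \<in> pmaps (ob X n) (pprod (P2_homs n) (\<lambda>_. ob (Hhat (Psi X)) 2))"
    using un gstar_Hfam[where M="Psi X" and n=n] unpt gpt F1_module_basepoints(2)[OF X] ptH
    by (auto simp: sq_left_def compose_def obH ppt ptuple_def gstar_def pmaps_def pprod_def[of "P2_homs n"] fun_eq_iff)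
  have ptH2: "pt (Pfam (ob X 1) 2) \<in> elems (Hfam (Psi X) 2)"
    using F1_module_Hhat[OF is_plasma_Psi[OF X]] unfolding F1_module_def pointed_def obH ppt[symmetric] by blast
  show "sq_bottom X n \<in> pmaps (pprod (P2_homs n) (\<lambda>_. ob (Hhat (Psi X)) 2)) (pprod (P2_homs n) (\<lambda>_. Pfam (ob X 1) 2))"
    using sub ptH2
    by (auto simp: sq_bottom_def obH ppt pprod_map_def pmaps_def pprod_def[of "P2_homs n"] PiE_iff fun_eq_iff)
  show "pcomp (ob X n) (sq_right X n) (sq_top X n) = pcomp (ob X n) (sq_bottom X n) (sq_left X n)"
  proof
    fix z show "pcomp (ob X n) (sq_right X n) (sq_top X n) z = pcomp (ob X n) (sq_bottom X n) (sq_left X n) z"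
      using un[of z] sub gstar_Hfam[where M="Psi X" and n=n]
      by (auto simp: compose_def top sq_right_def sq_left_def sq_bottom_def obH ptuple_def pprod_map_def pprod_def[of "P2_homs n"] gstar_def subset_iff fun_eq_iff)
  qed
qed

end

theory Submission
  imports Defs
begin

text \<open>
  Both conditions say that the unit \<open>\<eta> : X \<rightarrow> Hhat (Psi X)\<close> is bijective in every degree.

  For the square: a plasma morphism from \<open>Pplasma 2\<close> to \<open>Pplasma n\<close> is the same thing as a pair
  \<open>(S, T)\<close> of disjoint subsets of \<open>{1..n}\<close>, the images of \<open>{1}\<close> and \<open>{2}\<close>
  (\<open>disjoint_pair_P2_hom\<close>). The conditions cutting out \<open>Hfam M n\<close> among all families are indexed
  by such pairs, and the condition at \<open>(S, T)\<close> only involves the restriction of the family along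
  the corresponding morphism. So a family lies in \<open>Hfam M n\<close> as soon as all its restrictions lie
  in \<open>Hfam M 2\<close> (\<open>Hfam_iff_restrictions\<close>). Since the bottom map is injective, this identifies
  the fibre product of the square with \<open>Hfam (Psi X) n\<close>, and the comparison map from \<open>X\<^sub>n\<close> with
  \<open>\<eta>\<^sub>n\<close> (\<open>is_pullback_iff_bij_adj_unit\<close>).

  For the isomorphism: a natural transformation that is bijective in every degree is invertible,
  so a bijective unit yields \<open>X \<cong> Hhat (Psi X)\<close>. Conversely, an abstract isomorphism says nothing
  about the unit directly, but the unit is always bijective on modules of the form \<open>Hhat M\<close>
  (\<open>bij_adj_unit_Hhat\<close>, which reflects that the counit \<open>Psi (Hhat M) \<rightarrow> M\<close> is an isomorphism),
  and by its naturality in the module, its bijectivity is invariant under isomorphism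
  (\<open>bij_adj_unit_transport\<close>).
\<close>

section \<open>The fibre product of the square\<close>

lemma Hfam_car: "x \<in> elems (Hfam M n) \<Longrightarrow> S \<subseteq> {1..n} \<Longrightarrow> x S \<in> car M"
  by (auto simp: Hfam_def PiE_iff)

lemma Hfam_hyp:
  "x \<in> elems (Hfam M n) \<Longrightarrow> S \<subseteq> {1..n} \<Longrightarrow> T \<subseteq> {1..n} \<Longrightarrow> S \<inter> T = {} \<Longrightarrow>
     x (S \<union> T) \<in> hyp M (x S) (x T)"
  by (simp add: Hfam_def)

lemma disjoint_pair_P2_hom:
  assumes "S \<subseteq> {1..n}" "T \<subseteq> {1..n}" "S \<inter> T = {}"
  obtains g where "g \<in> P2_homs n" "g {1} = S" "g {2} = T" "g {1, 2} = S \<union> T"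
proof
  let ?g = "\<lambda>U\<in>Pow {1..2::nat}. (if 1 \<in> U then S else {}) \<union> (if 2 \<in> U then T else {})"
  show "?g \<in> P2_homs n"
    using assms by (auto simp: plasma_homs_def Pplasma_def)
qed auto

text \<open>The condition on \<open>x\<close> at a disjoint pair \<open>(S, T)\<close> is the condition at \<open>({1}, {2})\<close> on the
  restriction of \<open>x\<close> along the morphism that the pair determines; the pair \<open>({}, {})\<close> takes care
  of the value at \<open>{}\<close>.\<close>

lemma Hfam_iff_restrictions:
  "x \<in> elems (Hfam M n) \<longleftrightarrow>
     x \<in> Pow {1..n} \<rightarrow>\<^sub>E car M \<and>
     (\<forall>g\<in>P2_homs n. (\<lambda>T\<in>Pow {1..2}. x (g T)) \<in> elems (Hfam M 2))"
    (is "_ \<longleftrightarrow> ?E \<and> ?R")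
proof
  assume x: "x \<in> elems (Hfam M n)"
  then have "?E" by (simp add: Hfam_def)
  with x show "?E \<and> ?R" using gstar_Hfam by blast
next
  assume R: "?E \<and> ?R"
  have pair: "x {} = unt M \<and> x (S \<union> T) \<in> hyp M (x S) (x T)"
    if ST: "S \<subseteq> {1..n}" "T \<subseteq> {1..n}" "S \<inter> T = {}" for S T
  proof -
    obtain g where g: "g \<in> P2_homs n" "g {1} = S" "g {2} = T" "g {1, 2} = S \<union> T"
      using disjoint_pair_P2_hom[OF ST] .
    define y where "y = (\<lambda>U\<in>Pow {1..2}. x (g U))"
    have y: "y \<in> elems (Hfam M 2)" using R g(1) by (simp add: y_def)
    then have "y {} = unt M" by (simp add: Hfam_def)
    moreover have "y ({1} \<union> {2}) \<in> hyp M (y {1}) (y {2})"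
      using Hfam_hyp[OF y, of "{1}" "{2}"] by simp
    ultimately show ?thesis
      using g P2_hom_empty[OF g(1)] by (simp add: y_def insert_commute)
  qed
  show "x \<in> elems (Hfam M n)"
    using R pair[of "{}" "{}"] pair by (auto simp: Hfam_def)
qed

lemma pointed_target: "f \<in> pmaps A B \<Longrightarrow> pointed A \<Longrightarrow> pointed B"
  unfolding pmaps_def pointed_def by (metis (mono_tags, lifting) PiE_mem mem_Collect_eq)

lemma ob_Hhat: "ob (Hhat M) n = Hfam M n"
  by (simp add: Hhat_def)

lemma sq_top_eq_adj_unit: "sq_top X n = adj_unit X n"
  by (simp add: sq_top_def adj_unit_def ptuple_def)

text \<open>A point of the fibre product is determined by its component in \<open>Pfam (ob X 1) n\<close>, because the
  bottom map is an inclusion, and the first components that occur are the families all of whose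
  restrictions lie in \<open>Hfam (Psi X) 2\<close>.\<close>

lemma bij_fst_fibre_product:
  "bij_betw fst
     {(b, c). b \<in> elems (Pfam (ob X 1) n) \<and>
        c \<in> elems (pprod (P2_homs n) (\<lambda>_. ob (Hhat (Psi X)) 2)) \<and>
        sq_right X n b = sq_bottom X n c}
     (elems (Hfam (Psi X) n))"
    (is "bij_betw _ ?P _")
proof -
  let ?r = "\<lambda>b. \<lambda>g\<in>P2_homs n. \<lambda>T\<in>Pow {1..2}. b (g T)"
  have bot: "sq_bottom X n c = c" if "c \<in> elems (pprod (P2_homs n) (\<lambda>_. Hfam (Psi X) 2))" for c
    using that
    by (auto simp: sq_bottom_def ob_Hhat pprod_map_def pprod_def PiE_iff extensional_def fun_eq_iff)
  have right: "sq_right X n b = ?r b" if "b \<in> elems (Pfam (ob X 1) n)" for b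
    using that by (auto simp: sq_right_def ptuple_def gstar_def)
  have fam: "elems (Pfam (ob X 1) n) = Pow {1..n} \<rightarrow>\<^sub>E car (Psi X)"
    by (simp add: Pfam_def pprod_def Psi_def)
  have "(b, c) \<in> ?P \<longleftrightarrow> b \<in> elems (Hfam (Psi X) n) \<and> c = ?r b" for b c
  proof -
    have "?r b \<in> elems (pprod (P2_homs n) (\<lambda>_. Hfam (Psi X) 2)) \<longleftrightarrow>
        (\<forall>g\<in>P2_homs n. (\<lambda>T\<in>Pow {1..2}. b (g T)) \<in> elems (Hfam (Psi X) 2))"
      by (auto simp: pprod_def PiE_iff)
    then show ?thesis
      unfolding Hfam_iff_restrictions[of b "Psi X" n] fam[symmetric] ob_Hhat
      using bot right by auto
  qed
  then have "?P = (\<lambda>b. (b, ?r b)) ` elems (Hfam (Psi X) n)" by auto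
  then show ?thesis by (auto simp: bij_betw_def inj_on_def image_image)
qed

lemma is_pullback_iff_bij_adj_unit:
  assumes X: "F1_module X"
  shows "is_pullback (ob X n) (Pfam (ob X 1) n)
       (pprod (P2_homs n) (\<lambda>_. ob (Hhat (Psi X)) 2)) (pprod (P2_homs n) (\<lambda>_. Pfam (ob X 1) 2))
       (sq_top X n) (sq_left X n) (sq_right X n) (sq_bottom X n) \<longleftrightarrow>
     bij_betw (adj_unit X n) (elems (ob X n)) (elems (Hfam (Psi X) n))"
    (is "is_pullback ?A ?B ?C ?D ?f ?g ?h ?k \<longleftrightarrow> _")
proof -
  let ?P = "{(b, c). b \<in> elems ?B \<and> c \<in> elems ?C \<and> ?h b = ?k c}"
  let ?F = "\<lambda>a. (?f a, ?g a)"
  note sq = square_commutes[OF X, of n]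
  have ptA: "pointed ?A" using X by (simp add: F1_module_def)
  have pt: "pointed ?B" "pointed ?C" "pointed ?D"
    using ptA pointed_target[OF sq(1)] pointed_target[OF sq(2)] pointed_target[OF sq(3)] by auto
  have "is_pullback ?A ?B ?C ?D ?f ?g ?h ?k \<longleftrightarrow> bij_betw ?F (elems ?A) ?P"
  proof
    assume "bij_betw ?F (elems ?A) ?P"
    note univ = bij_imp_universal[OF this sq(1) sq(3) ptA]
    show "is_pullback ?A ?B ?C ?D ?f ?g ?h ?k"
      unfolding is_pullback_def using sq ptA pt univ by blast
  qed (rule is_pullback_bij)
  also have "\<dots> \<longleftrightarrow> bij_betw (fst \<circ> ?F) (elems ?A) (elems (Hfam (Psi X) n))"
  proof (rule bij_betw_comp_iff2[OF bij_fst_fibre_product])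
    have "?h (?f a) = ?k (?g a)" if "a \<in> elems ?A" for a
      using fun_cong[OF sq(5), of a] that by (simp add: compose_eq)
    then show "?F ` elems ?A \<subseteq> ?P"
      using sq(1,3) by (auto simp: pmaps_def)
  qed
  also have "fst \<circ> ?F = adj_unit X n"
    by (simp add: comp_def sq_top_eq_adj_unit)
  finally show ?thesis .
qed

section \<open>Isomorphisms and the unit\<close>

lemma nat_trans_closed:
  assumes "nat_trans X Y f" "x \<in> elems (ob X n)"
  shows "f n x \<in> elems (ob Y n)"
  using assms by (auto simp: nat_trans_def pmaps_def)

lemma nat_trans_act:
  assumes "nat_trans X Y f" "\<phi> \<in> pmaps (Fin n) (Fin m)" "x \<in> elems (ob X n)"
  shows "f m (act X n m \<phi> x) = act Y n m \<phi> (f n x)"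
proof -
  have "pcomp (ob X n) (f m) (act X n m \<phi>) = pcomp (ob X n) (act Y n m \<phi>) (f n)"
    using assms(1,2) by (simp add: nat_trans_def)
  from fun_cong[OF this, of x] show ?thesis using assms(3) by (simp add: compose_eq)
qed

lemma bij_nat_trans_imp_F1_iso:
  assumes X: "F1_module X" and Y: "F1_module Y" and f: "nat_trans X Y f"
    and bij: "\<And>n. bij_betw (f n) (elems (ob X n)) (elems (ob Y n))"
  shows "F1_iso X Y"
proof -
  define g where "g n = restrict (inv_into (elems (ob X n)) (f n)) (elems (ob Y n))" for n
  have gf: "g n (f n x) = x" if "x \<in> elems (ob X n)" for n x
    using bij[of n] that by (auto simp: g_def bij_betw_def)
  have gm: "g n y \<in> elems (ob X n)" and fg: "f n (g n y) = y" if "y \<in> elems (ob Y n)" for n y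
    using bij[of n] that by (auto simp: g_def bij_betw_def inv_into_into f_inv_into_f)
  have gpt: "g n (pt (ob Y n)) = pt (ob X n)" for n
  proof -
    have "f n (pt (ob X n)) = pt (ob Y n)" using f by (simp add: nat_trans_def pmaps_def)
    then show ?thesis using gf[of "pt (ob X n)" n] F1_module_basepoints(2)[OF X, of n] by simp
  qed
  have gnat: "g m (act Y n m \<phi> y) = act X n m \<phi> (g n y)"
    if p: "\<phi> \<in> pmaps (Fin n) (Fin m)" and y: "y \<in> elems (ob Y n)" for n m \<phi> y
    using gf[OF F1_module_closed[OF X p gm[OF y]]] nat_trans_act[OF f p gm[OF y]] fg[OF y] by simp
  have "nat_trans Y X g"
    unfolding nat_trans_def
    using gm gpt gnat by (auto simp: pmaps_def compose_def fun_eq_iff g_def)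
  moreover have "pcomp (ob X n) (g n) (f n) = pid (ob X n)"
      "pcomp (ob Y n) (f n) (g n) = pid (ob Y n)" for n
    using gf fg by (auto simp: compose_def pid_def fun_eq_iff)
  ultimately show ?thesis unfolding F1_iso_def using f by blast
qed

text \<open>Injectivity and surjectivity of the unit, expressed through the maps \<open>\<rho>\<^sub>S\<close>. In this form they
  can be moved along natural transformations, which commute with every \<open>\<rho>\<^sub>S\<close>.\<close>

lemma bij_adj_unit_iff:
  assumes X: "F1_module X"
  shows "bij_betw (adj_unit X n) (elems (ob X n)) (elems (Hfam (Psi X) n)) \<longleftrightarrow>
    (\<forall>z\<in>elems (ob X n). \<forall>z'\<in>elems (ob X n).
       (\<forall>S\<subseteq>{1..n}. act X n 1 (rho n S) z = act X n 1 (rho n S) z') \<longrightarrow> z = z') \<and>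
    (\<forall>x\<in>elems (Hfam (Psi X) n). \<exists>z\<in>elems (ob X n). \<forall>S\<subseteq>{1..n}. act X n 1 (rho n S) z = x S)"
    (is "?bij \<longleftrightarrow> ?inj \<and> ?sur")
proof -
  have eq: "adj_unit X n z = x \<longleftrightarrow> (\<forall>S\<subseteq>{1..n}. act X n 1 (rho n S) z = x S)"
    if "z \<in> elems (ob X n)" "x \<in> elems (Hfam (Psi X) n)" for z x
    using that by (auto simp: adj_unit_def Hfam_def PiE_iff extensional_def fun_eq_iff)
  have mem: "adj_unit X n z \<in> elems (Hfam (Psi X) n)" if "z \<in> elems (ob X n)" for z
    using adj_unit_mem[OF X that] by (simp add: ob_Hhat)
  have val: "adj_unit X n z S = act X n 1 (rho n S) z"
    if "z \<in> elems (ob X n)" "S \<subseteq> {1..n}" for z S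
    using that by (simp add: adj_unit_def)
  have "inj_on (adj_unit X n) (elems (ob X n)) \<longleftrightarrow> ?inj"
    unfolding inj_on_def using eq mem val by auto
  moreover have "adj_unit X n ` elems (ob X n) = elems (Hfam (Psi X) n) \<longleftrightarrow> ?sur"
  proof -
    have "adj_unit X n ` elems (ob X n) \<subseteq> elems (Hfam (Psi X) n)" using mem by auto
    then have "adj_unit X n ` elems (ob X n) = elems (Hfam (Psi X) n) \<longleftrightarrow>
        (\<forall>x\<in>elems (Hfam (Psi X) n). x \<in> adj_unit X n ` elems (ob X n))" by blast
    also have "\<dots> \<longleftrightarrow> ?sur"
      unfolding image_iff using eq by (simp add: eq_commute[of _ "adj_unit X n _"])
    finally show ?thesis .
  qed
  ultimately show ?thesis by (simp add: bij_betw_def)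
qed

text \<open>An element of \<open>(Hhat M)\<^sub>1\<close> is a family on the two subsets of \<open>{1}\<close> whose value at \<open>{}\<close> is
  fixed, hence amounts to its value at \<open>{1}\<close>. Under this identification \<open>\<rho>\<^sub>S\<close> is evaluation at \<open>S\<close>
  and \<open>Psi (Hhat M)\<close> becomes \<open>M\<close>.\<close>

lemma act_Hhat_rho:
  assumes "z \<in> elems (Hfam M n)" "S \<subseteq> {1..n}"
  shows "act (Hhat M) n 1 (rho n S) z = (\<lambda>T\<in>Pow {1}. if T = {} then unt M else z S)"
proof -
  have "{i \<in> {0..n}. rho n S i \<in> {}} = {}" "{i \<in> {0..n}. rho n S i \<in> {1}} = S"
    using assms(2) by (auto simp: rho_def)
  moreover have "z {} = unt M" using assms(1) by (simp add: Hfam_def)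
  ultimately show ?thesis
    using assms(1) by (auto simp: Hhat_def fun_eq_iff subset_singleton_iff)
qed

text \<open>Evaluating at \<open>{1}\<close> the members of a family in \<open>Psi (Hhat M)\<close> gives its preimage. That this is
  a point of \<open>Hfam M n\<close> holds because a witness \<open>w \<in> (Hhat M)\<^sub>2\<close> for the hyperoperation of
  \<open>Psi (Hhat M)\<close> is itself a family, and thus satisfies the condition for the hyperoperation of \<open>M\<close>.\<close>

lemma bij_adj_unit_Hhat:
  assumes M: "is_plasma M"
  shows "bij_betw (adj_unit (Hhat M) n) (elems (ob (Hhat M) n)) (elems (Hfam (Psi (Hhat M)) n))"
  unfolding bij_adj_unit_iff[OF F1_module_Hhat[OF M]]
  unfolding ob_Hhat
proof (intro conjI ballI impI)
  fix z z' assume z: "z \<in> elems (Hfam M n)" "z' \<in> elems (Hfam M n)"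
    and e: "\<forall>S\<subseteq>{1..n}. act (Hhat M) n 1 (rho n S) z = act (Hhat M) n 1 (rho n S) z'"
  have "z S = z' S" if "S \<subseteq> {1..n}" for S
    using fun_cong[OF e[rule_format, OF that], of "{1}"] z that
    by (simp add: act_Hhat_rho del: One_nat_def)
  moreover have "z \<in> Pow {1..n} \<rightarrow>\<^sub>E car M" "z' \<in> Pow {1..n} \<rightarrow>\<^sub>E car M"
    using z by (simp_all add: Hfam_def)
  ultimately show "z = z'" by (intro PiE_ext[of z _ _ z']) auto
next
  fix x assume x: "x \<in> elems (Hfam (Psi (Hhat M)) n)"
  \<comment> \<open>The members \<open>x S\<close> are themselves families, indexed by the subsets of \<open>{1}\<close>.\<close>
  define z where "z = (\<lambda>S\<in>Pow {1..n}. x S {1})"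
  have unt: "unt (Psi (Hhat M)) = (\<lambda>T\<in>Pow {1}. unt M)"
    using F1_module_basepoints(1)[OF F1_module_Hhat[OF M]] by (simp add: ob_Hhat Hfam_def)
  have xS: "x S \<in> elems (Hfam M 1)" if "S \<subseteq> {1..n}" for S
    using Hfam_car[OF x that] by (simp add: Psi_def ob_Hhat)
  have "z (S \<union> T) \<in> hyp M (z S) (z T)"
    if ST: "S \<subseteq> {1..n}" "T \<subseteq> {1..n}" "S \<inter> T = {}" for S T
  proof -
    have "x (S \<union> T) \<in> hyp (Psi (Hhat M)) (x S) (x T)"
      by (rule Hfam_hyp[OF x ST])
    then obtain w where w: "w \<in> elems (Hfam M 2)"
      "act (Hhat M) 2 1 (rho 2 {1}) w = x S" "act (Hhat M) 2 1 (rho 2 {2}) w = x T"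
      "act (Hhat M) 2 1 (rho 2 {1, 2}) w = x (S \<union> T)"
      by (auto simp: Psi_def ob_Hhat)
    have ev: "act (Hhat M) 2 1 (rho 2 U) w {1} = w U" if "U \<subseteq> {1..2}" for U
      using act_Hhat_rho[OF w(1) that] by simp
    have "w {1} = z S" "w {2} = z T" "w {1, 2} = z (S \<union> T)"
      using ev[of "{1}"] ev[of "{2}"] ev[of "{1, 2}"] ST unfolding w by (auto simp: z_def)
    moreover have "w ({1} \<union> {2}) \<in> hyp M (w {1}) (w {2})"
      using Hfam_hyp[OF w(1), of "{1}" "{2}"] by simp
    ultimately show ?thesis by (simp add: insert_commute)
  qed
  moreover have "x {} = unt (Psi (Hhat M))" using x by (simp add: Hfam_def)
  then have "z {} = unt M" by (simp add: z_def unt)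
  moreover have "x S {1} \<in> car M" if "S \<subseteq> {1..n}" for S
    using Hfam_car[OF xS[OF that], of "{1}"] by simp
  ultimately have z: "z \<in> elems (Hfam M n)"
    by (auto simp: Hfam_def z_def)
  have "act (Hhat M) n 1 (rho n S) z = x S" if S: "S \<subseteq> {1..n}" for S
  proof -
    have "x S = (\<lambda>T\<in>Pow {1}. if T = {} then unt M else x S {1})"
      using xS[OF S] by (auto simp: Hfam_def PiE_iff extensional_def fun_eq_iff subset_singleton_iff)
    also have "x S {1} = z S" using S by (simp add: z_def)
    finally show ?thesis using act_Hhat_rho[OF z S] by (simp only:)
  qed
  with z show "\<exists>z\<in>elems (Hfam M n). \<forall>S\<subseteq>{1..n}. act (Hhat M) n 1 (rho n S) z = x S" by blast
qed

text \<open>The effect of \<open>Hhat (Psi f)\<close> on elements.\<close>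

lemma nat_trans_Hfam_Psi:
  assumes X: "F1_module X" and Y: "F1_module Y" and f: "nat_trans X Y f"
    and x: "x \<in> elems (Hfam (Psi X) n)"
  shows "(\<lambda>S\<in>Pow {1..n}. f 1 (x S)) \<in> elems (Hfam (Psi Y) n)"
proof -
  have "f 1 c \<in> hyp (Psi Y) (f 1 a) (f 1 b)" if c: "c \<in> hyp (Psi X) a b" for a b c
  proof -
    obtain w where w: "w \<in> elems (ob X 2)" "act X 2 1 (rho 2 {1}) w = a"
      "act X 2 1 (rho 2 {2}) w = b" "act X 2 1 (rho 2 {1, 2}) w = c"
      using c by (auto simp: Psi_def)
    have "act Y 2 1 (rho 2 U) (f 2 w) = f 1 (act X 2 1 (rho 2 U) w)" if "U \<subseteq> {1..2}" for U
      using nat_trans_act[OF f rho_pmaps[OF that] w(1)] by simp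
    then show ?thesis
      using nat_trans_closed[OF f w(1)] w(2-4) by (auto simp: Psi_def intro!: exI[of _ "f 2 w"])
  qed
  moreover have "f 1 (unt (Psi X)) = unt (Psi Y)"
    using f by (simp add: F1_module_basepoints X Y nat_trans_def pmaps_def)
  ultimately show ?thesis
    using x nat_trans_closed[OF f, of _ 1] by (auto simp: Hfam_def Psi_def[of X] Psi_def[of Y] PiE_iff)
qed

text \<open>A family over \<open>X\<close> is pushed to \<open>Y\<close>, lifted there, and the lift is pulled back by the inverse
  isomorphism; naturality with respect to \<open>\<rho>\<^sub>S\<close> shows that this is a lift of the family.\<close>

lemma bij_adj_unit_transport:
  assumes X: "F1_module X" and Y: "F1_module Y" and iso: "F1_iso X Y"
    and bij: "bij_betw (adj_unit Y n) (elems (ob Y n)) (elems (Hfam (Psi Y) n))"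
  shows "bij_betw (adj_unit X n) (elems (ob X n)) (elems (Hfam (Psi X) n))"
proof -
  obtain f g where f: "nat_trans X Y f" and g: "nat_trans Y X g"
    and inv: "\<And>n. pcomp (ob X n) (g n) (f n) = pid (ob X n)"
    using iso unfolding F1_iso_def by blast
  have gf: "g m (f m z) = z" if "z \<in> elems (ob X m)" for m z
    using fun_cong[OF inv[of m], of z] that by (simp add: compose_eq pid_def)
  have inj: "\<And>z z'. z \<in> elems (ob Y n) \<Longrightarrow> z' \<in> elems (ob Y n) \<Longrightarrow>
      (\<And>S. S \<subseteq> {1..n} \<Longrightarrow> act Y n 1 (rho n S) z = act Y n 1 (rho n S) z') \<Longrightarrow> z = z'"
    and sur: "\<And>x. x \<in> elems (Hfam (Psi Y) n) \<Longrightarrow>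
      \<exists>z\<in>elems (ob Y n). \<forall>S\<subseteq>{1..n}. act Y n 1 (rho n S) z = x S"
    using bij unfolding bij_adj_unit_iff[OF Y] by blast+
  show ?thesis
    unfolding bij_adj_unit_iff[OF X]
  proof (intro conjI ballI impI)
    fix z z' assume z: "z \<in> elems (ob X n)" "z' \<in> elems (ob X n)"
      and e: "\<forall>S\<subseteq>{1..n}. act X n 1 (rho n S) z = act X n 1 (rho n S) z'"
    have "f n z = f n z'"
    proof (rule inj)
      fix S assume S: "S \<subseteq> {1..n}"
      show "act Y n 1 (rho n S) (f n z) = act Y n 1 (rho n S) (f n z')"
        using nat_trans_act[OF f rho_pmaps[OF S]] z e S by metis
    qed (use nat_trans_closed[OF f] z in auto)
    then show "z = z'" using gf z by metis
  next
    fix x assume x: "x \<in> elems (Hfam (Psi X) n)"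
    obtain y where y: "y \<in> elems (ob Y n)"
      and yS: "\<And>S. S \<subseteq> {1..n} \<Longrightarrow> act Y n 1 (rho n S) y = f 1 (x S)"
      using sur[OF nat_trans_Hfam_Psi[OF X Y f x]] by auto
    have "act X n 1 (rho n S) (g n y) = x S" if S: "S \<subseteq> {1..n}" for S
    proof -
      have "x S \<in> elems (ob X 1)" using Hfam_car[OF x S] by (simp add: Psi_def)
      then show ?thesis using nat_trans_act[OF g rho_pmaps[OF S] y] yS[OF S] gf by simp
    qed
    then show "\<exists>z\<in>elems (ob X n). \<forall>S\<subseteq>{1..n}. act X n 1 (rho n S) z = x S"
      using nat_trans_closed[OF g y] by blast
  qed
qed

theorem corollary4p13:
  fixes X :: "'a fin_functor"
  assumes "F1_module X"
  shows "F1_iso X (Hhat (Psi X)) \<longleftrightarrow>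
    (\<forall>n. is_pullback
       (ob X n)
       (Pfam (ob X 1) n)
       (pprod (P2_homs n) (\<lambda>_. ob (Hhat (Psi X)) 2))
       (pprod (P2_homs n) (\<lambda>_. Pfam (ob X 1) 2))
       (sq_top X n) (sq_left X n) (sq_right X n) (sq_bottom X n))"
proof -
  have H: "F1_module (Hhat (Psi X))"
    by (rule F1_module_Hhat[OF is_plasma_Psi[OF assms]])
  have "F1_iso X (Hhat (Psi X)) \<longleftrightarrow>
      (\<forall>n. bij_betw (adj_unit X n) (elems (ob X n)) (elems (Hfam (Psi X) n)))"
  proof
    assume "F1_iso X (Hhat (Psi X))"
    then show "\<forall>n. bij_betw (adj_unit X n) (elems (ob X n)) (elems (Hfam (Psi X) n))"
      using bij_adj_unit_transport[OF assms H] bij_adj_unit_Hhat[OF is_plasma_Psi[OF assms]]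
      by blast
  next
    assume "\<forall>n. bij_betw (adj_unit X n) (elems (ob X n)) (elems (Hfam (Psi X) n))"
    then show "F1_iso X (Hhat (Psi X))"
      using bij_nat_trans_imp_F1_iso[OF assms H nat_trans_adj_unit[OF assms]]
      by (simp add: ob_Hhat)
  qed
  then show ?thesis using is_pullback_iff_bij_adj_unit[OF assms] by blast
qed

end
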